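(* Let a group $G$ act on $\mathbb{C}^n$ and suppose $P:\mathbb{C}^n\to\mathbb{C}^N$ is a polynomial $G$-invariant map such that the induced map $\tilde P:\mathbb{C}^n/G\to\mathbb{C}^N$ is injective. Then for every $k\ge 2n+1$, the map $\ell\circ\tilde P:\mathbb{C}^n/G\to\mathbb{C}^k$ is injective for a generic linear map $\ell:\mathbb{C}^N\to\mathbb{C}^k$.
   Context: $\mathbb{C}^n/G$ is the set of orbits $[x]$ of the action. A map $P$ on $\mathbb{C}^n$ is $G$-invariant if $P(gx)=P(x)$ for all $g\in G$, $x\in\mathbb{C}^n$; it then induces $\tilde P([x])=P(x)$. A polynomial map is one all of whose components are polynomials in the coordinates $x_1,\dots,x_n$ with complex coefficients. A property holds for a generic linear map $\ell:\mathbb{C}^N\to\mathbb{C}^k$ if it holds for all $\ell$ (viewed as matrices in $\mathbb{C}^{k\times N}$) outside some proper Zariski-closed subset of $\mathbb{C}^{k\times N}$. *)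

theory Defs
  imports "HOL-Analysis.Analysis" "HOL-Algebra.Group_Action"
begin

text \<open>Coordinates are indexed by an arbitrary finite type, so that the same notion serves both
  for \<open>complex ^ 'n\<close> and for matrices (index type \<open>'k \<times> 'N\<close>).\<close>

definition complex_polynomial :: "(('i::finite \<Rightarrow> complex) \<Rightarrow> complex) \<Rightarrow> bool" where
  "complex_polynomial f \<longleftrightarrow>
     (\<exists>(A :: ('i \<Rightarrow> nat) set) c. finite A \<and>
        (\<forall>x. f x = (\<Sum>\<alpha>\<in>A. c \<alpha> * (\<Prod>i\<in>UNIV. x i ^ \<alpha> i))))"

definition polynomial_map :: "(complex ^ 'n \<Rightarrow> complex ^ 'N) \<Rightarrow> bool" where
  "polynomial_map P \<longleftrightarrow>
     (\<forall>j. \<exists>f. complex_polynomial f \<and> (\<forall>x. P x $ j = f (\<lambda>i. x $ i)))"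

definition zariski_closed :: "(complex ^ 'N ^ 'k) set \<Rightarrow> bool" where
  "zariski_closed Z \<longleftrightarrow>
     (\<exists>F. (\<forall>f\<in>F. complex_polynomial f) \<and>
          Z = {A. \<forall>f\<in>F. f (\<lambda>(i, j). A $ i $ j) = 0})"

definition generic_linear_map :: "((complex ^ 'N \<Rightarrow> complex ^ 'k) \<Rightarrow> bool) \<Rightarrow> bool" where
  "generic_linear_map Q \<longleftrightarrow>
     (\<exists>Z. zariski_closed Z \<and> Z \<noteq> UNIV \<and>
          (\<forall>l. Vector_Spaces.linear (*s) (*s) l \<and> matrix l \<notin> Z \<longrightarrow> Q l))"

definition invariant_map ::
  "('g, 'm) monoid_scheme \<Rightarrow> ('g \<Rightarrow> 'a \<Rightarrow> 'a) \<Rightarrow> ('a \<Rightarrow> 'b) \<Rightarrow> bool" where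
  "invariant_map G \<phi> P \<longleftrightarrow> (\<forall>g\<in>carrier G. \<forall>x. P (\<phi> g x) = P x)"

text \<open>An invariant \<open>P\<close> is constant on each orbit \<open>X\<close>, so \<open>P ` X\<close> is a singleton, and its
  element is the value of the induced map at \<open>X\<close>.\<close>

definition induced_map :: "('a \<Rightarrow> 'b) \<Rightarrow> 'a set \<Rightarrow> 'b" where
  "induced_map P X = the_elem (P ` X)"

lemma induced_map_orbit:
  assumes "group_action G UNIV \<phi>" and "invariant_map G \<phi> P"
  shows "induced_map P (orbit G \<phi> x) = P x"
proof -
  interpret group_action G UNIV \<phi> by fact
  have "x \<in> orbit G \<phi> x"
    using orbit_refl by simp
  moreover have "P y = P x" if "y \<in> orbit G \<phi> x" for y
    using that assms(2) by (auto simp: orbit_def invariant_map_def)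
  ultimately have "P ` orbit G \<phi> x = {P x}"
    by blast
  then show ?thesis
    by (simp add: induced_map_def)
qed

end

theory Submission
  imports Defs "HOL-Computational_Algebra.Polynomial"
begin

text \<open>If \<open>l\<close> fails to be injective on the image, then \<open>l w = 0\<close> for some \<open>w = P x - P y\<close> with an
  entry \<open>w\<^sub>j \<noteq> 0\<close>, so each entry \<open>l\<^sub>r\<^sub>j\<close> is a rational function, with denominator \<open>w\<^sub>j\<close>, of \<open>x\<close>, \<open>y\<close>
  and the entries outside column \<open>j\<close>. These are only \<open>2 n + k (N - 1) < k N\<close> parameters. Hence for
  large \<open>D\<close> the polynomials in the entries of \<open>l\<close> with exponents at most \<open>D\<close> outnumber the linear
  conditions (for all \<open>j\<close> together) expressing that such a polynomial vanishes at every bad \<open>l\<close>.\<close>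

section \<open>Polynomial functions of bounded multidegree\<close>

definition monomial_fun :: "('i::finite \<Rightarrow> nat) \<Rightarrow> ('i \<Rightarrow> 'a::comm_ring_1) \<Rightarrow> 'a" where
  "monomial_fun \<alpha> x = (\<Prod>i\<in>UNIV. x i ^ \<alpha> i)"

text \<open>Degrees are bounded in each variable separately: a bound 0 then says that a variable
  does not occur, and the number of admissible monomials is a plain product.\<close>

definition polys_le :: "('i::finite \<Rightarrow> nat) \<Rightarrow> (('i \<Rightarrow> 'a::comm_ring_1) \<Rightarrow> 'a) set" where
  "polys_le e = {f. \<exists>c. \<forall>x. f x = (\<Sum>\<alpha>\<in>{..e}. c \<alpha> * monomial_fun \<alpha> x)}"

lemma atMost_fun_eq_PiE: "{..e :: 'i \<Rightarrow> nat} = PiE UNIV (\<lambda>i. {..e i})"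
  by (auto simp: le_fun_def PiE_def Pi_def)

lemma finite_atMost_fun [simp]: "finite {..e :: 'i::finite \<Rightarrow> nat}"
  by (simp add: atMost_fun_eq_PiE finite_PiE)

lemma card_atMost_fun: "card {..e :: 'i::finite \<Rightarrow> nat} = (\<Prod>i\<in>UNIV. Suc (e i))"
  by (simp add: atMost_fun_eq_PiE card_PiE)

lemma monomial_fun_add: "monomial_fun (\<lambda>i. \<alpha> i + \<beta> i) x = monomial_fun \<alpha> x * monomial_fun \<beta> x"
  by (simp add: monomial_fun_def power_add prod.distrib)

lemma monomial_fun_in_polys_le: "\<alpha> \<le> e \<Longrightarrow> monomial_fun \<alpha> \<in> polys_le e"
  unfolding polys_le_def
  by (auto intro!: exI[of _ "\<lambda>\<beta>. if \<beta> = \<alpha> then 1 else 0"] simp: if_distrib[of "\<lambda>c. c * _"] cong: if_cong)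

lemma polys_le_scale: "f \<in> polys_le e \<Longrightarrow> (\<lambda>x. a * f x) \<in> polys_le e"
proof -
  assume "f \<in> polys_le e"
  then obtain c where "\<And>x. f x = (\<Sum>\<alpha>\<in>{..e}. c \<alpha> * monomial_fun \<alpha> x)" by (auto simp: polys_le_def)
  then show ?thesis
    by (auto simp: polys_le_def sum_distrib_left mult.assoc intro!: exI[of _ "\<lambda>\<alpha>. a * c \<alpha>"])
qed

lemma polys_le_add:
  assumes "f \<in> polys_le e" "g \<in> polys_le e"
  shows "(\<lambda>x. f x + g x) \<in> polys_le e"
proof -
  obtain c d where "\<And>x. f x = (\<Sum>\<alpha>\<in>{..e}. c \<alpha> * monomial_fun \<alpha> x)" "\<And>x. g x = (\<Sum>\<alpha>\<in>{..e}. d \<alpha> * monomial_fun \<alpha> x)"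
    using assms by (auto simp: polys_le_def)
  then show ?thesis
    by (auto simp: polys_le_def sum.distrib distrib_right intro!: exI[of _ "\<lambda>\<alpha>. c \<alpha> + d \<alpha>"])
qed

lemma polys_le_uminus: "f \<in> polys_le e \<Longrightarrow> (\<lambda>x. - f x) \<in> polys_le e"
  using polys_le_scale[of f e "- 1"] by simp

lemma polys_le_diff: "f \<in> polys_le e \<Longrightarrow> g \<in> polys_le e \<Longrightarrow> (\<lambda>x. f x - g x) \<in> polys_le e"
  using polys_le_add[of f e "\<lambda>x. - g x"] polys_le_uminus[of g e] by simp

lemma polys_le_zero: "(\<lambda>x. 0) \<in> polys_le e"
  by (auto simp: polys_le_def intro!: exI[of _ "\<lambda>_. 0"])

lemma polys_le_sum:
  assumes "\<And>a. a \<in> A \<Longrightarrow> f a \<in> polys_le e"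
  shows "(\<lambda>x. \<Sum>a\<in>A. f a x) \<in> polys_le e"
  using assms by (induction A rule: infinite_finite_induct) (auto intro: polys_le_add polys_le_zero)

lemma polys_le_one: "(\<lambda>x. 1) \<in> polys_le e"
  using monomial_fun_in_polys_le[of "\<lambda>_. 0" e] by (simp add: le_fun_def monomial_fun_def[abs_def])

lemma polys_le_mono:
  assumes "f \<in> polys_le e" "e \<le> e'"
  shows "f \<in> polys_le e'"
proof -
  obtain c where "f = (\<lambda>x. \<Sum>\<alpha>\<in>{..e}. c \<alpha> * monomial_fun \<alpha> x)"
    using assms by (auto simp: polys_le_def)
  moreover have "(\<lambda>x. \<Sum>\<alpha>\<in>{..e}. c \<alpha> * monomial_fun \<alpha> x) \<in> polys_le e'"
    using assms(2) by (intro polys_le_sum polys_le_scale monomial_fun_in_polys_le) auto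
  ultimately show ?thesis by simp
qed

lemma polys_le_mult:
  assumes "f \<in> polys_le e" "g \<in> polys_le e'"
  shows "(\<lambda>x. f x * g x) \<in> polys_le (\<lambda>i. e i + e' i)"
proof -
  obtain c d where "\<And>x. f x = (\<Sum>\<alpha>\<in>{..e}. c \<alpha> * monomial_fun \<alpha> x)" "\<And>x. g x = (\<Sum>\<alpha>\<in>{..e'}. d \<alpha> * monomial_fun \<alpha> x)"
    using assms by (auto simp: polys_le_def)
  then have "(\<lambda>x. f x * g x)
      = (\<lambda>x. \<Sum>\<alpha>\<in>{..e}. \<Sum>\<beta>\<in>{..e'}. c \<alpha> * (d \<beta> * monomial_fun (\<lambda>i. \<alpha> i + \<beta> i) x))"
    by (simp add: sum_product monomial_fun_add mult_ac)
  moreover have "\<dots> \<in> polys_le (\<lambda>i. e i + e' i)"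
    by (intro polys_le_sum polys_le_scale monomial_fun_in_polys_le) (auto simp: le_fun_def intro: add_mono)
  ultimately show ?thesis by simp
qed

lemma polys_le_power: "f \<in> polys_le e \<Longrightarrow> (\<lambda>x. f x ^ m) \<in> polys_le (\<lambda>i. m * e i)"
  by (induction m) (auto intro: polys_le_one polys_le_mult)

lemma polys_le_prod:
  assumes "finite A" "\<And>a. a \<in> A \<Longrightarrow> f a \<in> polys_le (e a)"
  shows "(\<lambda>x. \<Prod>a\<in>A. f a x) \<in> polys_le (\<lambda>i. \<Sum>a\<in>A. e a i)"
  using assms by (induction A rule: finite_induct) (auto intro: polys_le_one polys_le_mult)

lemma polys_le_var:
  fixes i :: "'i::finite"
  shows "(\<lambda>x. x i :: 'a::comm_ring_1) \<in> polys_le (\<lambda>i'. if i' = i then 1 else 0)"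
    (is "_ \<in> polys_le ?\<delta>")
proof -
  have "monomial_fun ?\<delta> = (\<lambda>x. x i :: 'a)"
    by (simp add: fun_eq_iff monomial_fun_def if_distrib cong: if_cong)
  moreover have "(monomial_fun ?\<delta> :: _ \<Rightarrow> 'a) \<in> polys_le ?\<delta>"
    by (rule monomial_fun_in_polys_le[OF order_refl])
  ultimately show ?thesis by (simp only:)
qed

text \<open>With \<open>h = Inl\<close> or \<open>h = Inr\<close> this places a polynomial in
  \<open>x\<close> or in \<open>y\<close> alone among the polynomials in the pair
  \<open>(x, y)\<close>. Outside the range of \<open>h\<close> the bound \<open>e\<close> is
  unrestricted, since no such variable occurs.\<close>

lemma complex_polynomial_reindex_polys_le:
  assumes "complex_polynomial f"
  shows "\<exists>d. \<forall>e. (\<forall>i. d \<le> e (h i)) \<longrightarrow> (\<lambda>x. f (\<lambda>i. x (h i))) \<in> polys_le e"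
proof -
  obtain A c where A: "finite A" and f: "\<And>x. f x = (\<Sum>\<alpha>\<in>A. c \<alpha> * (\<Prod>i\<in>UNIV. x i ^ \<alpha> i))"
    using assms by (auto simp: complex_polynomial_def)
  \<comment> \<open>\<open>h\<close> may identify variables, and then their exponents add up; the
    total of all exponents bounds every such sum.\<close>
  let ?d = "\<Sum>\<alpha>\<in>A. \<Sum>i\<in>UNIV. \<alpha> i"
  have "(\<lambda>x. \<Prod>i\<in>UNIV. x (h i) ^ \<alpha> i) \<in> polys_le e"
    if "\<alpha> \<in> A" and e: "\<forall>i. ?d \<le> e (h i)" for \<alpha> and e
  proof (rule polys_le_mono[OF polys_le_prod])
    show "(\<lambda>x. x (h i) ^ \<alpha> i) \<in> polys_le (\<lambda>j. \<alpha> i * (if j = h i then 1 else 0))" for i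
      by (rule polys_le_power[OF polys_le_var])
    show "(\<lambda>j. \<Sum>i\<in>UNIV. \<alpha> i * (if j = h i then 1 else 0)) \<le> e"
    proof (rule le_funI)
      fix j
      show "(\<Sum>i\<in>UNIV. \<alpha> i * (if j = h i then 1 else 0)) \<le> e j"
      proof (cases "\<exists>i. j = h i")
        case True
        have "(\<Sum>i\<in>UNIV. \<alpha> i * (if j = h i then 1 else 0)) \<le> (\<Sum>i\<in>UNIV. \<alpha> i)"
          by (rule sum_mono) simp
        also have "\<dots> \<le> ?d"
          using that(1) A by (intro member_le_sum[of \<alpha> A "\<lambda>\<alpha>. sum \<alpha> UNIV"]) auto
        finally show ?thesis using e True by (metis order_trans)
      qed simp
    qed
  qed simp
  then show ?thesis
    unfolding f by (intro exI[of _ ?d] allI impI polys_le_sum polys_le_scale) auto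
qed

section \<open>Nonvanishing by Kronecker substitution\<close>

text \<open>Reduction modulo \<open>B\<close> isolates the lowest digit; cancelling it and dividing
  by \<open>B\<close> leaves one digit fewer.\<close>

lemma digits_unique:
  fixes a b :: "nat \<Rightarrow> nat"
  assumes "\<And>i. i < n \<Longrightarrow> a i < B" "\<And>i. i < n \<Longrightarrow> b i < B"
    and "(\<Sum>i<n. a i * B ^ i) = (\<Sum>i<n. b i * B ^ i)" and "i < n"
  shows "a i = b i"
  using assms
proof (induction n arbitrary: a b i)
  case (Suc n)
  have *: "(\<Sum>i<Suc n. f i * B ^ i) = f 0 + B * (\<Sum>i<n. f (Suc i) * B ^ i)" for f :: "nat \<Rightarrow> nat"
    unfolding sum.lessThan_Suc_shift by (simp add: sum_distrib_left mult_ac)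
  have lt: "a 0 < B" "b 0 < B" using Suc.prems by auto
  have eq: "a 0 + B * (\<Sum>i<n. a (Suc i) * B ^ i) = b 0 + B * (\<Sum>i<n. b (Suc i) * B ^ i)"
    using Suc.prems(3) unfolding * .
  have "a 0 = b 0"
    using arg_cong[OF eq, of "\<lambda>m. m mod B"] lt by simp
  then have eq': "(\<Sum>i<n. a (Suc i) * B ^ i) = (\<Sum>i<n. b (Suc i) * B ^ i)"
    using eq lt by simp
  show ?case
  proof (cases i)
    case 0
    then show ?thesis using \<open>a 0 = b 0\<close> by simp
  next
    case (Suc m)
    have "a (Suc m) = b (Suc m)"
    proof (rule Suc.IH[OF _ _ eq'])
      show "a (Suc j) < B" if "j < n" for j using Suc.prems(1)[of "Suc j"] that by simp
      show "b (Suc j) < B" if "j < n" for j using Suc.prems(2)[of "Suc j"] that by simp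
      show "m < n" using Suc Suc.prems(4) by simp
    qed
    then show ?thesis using Suc by simp
  qed
qed simp

text \<open>Kronecker substitution: putting suitable powers of a single \<open>t\<close> for the
  variables sends distinct monomials to distinct powers of \<open>t\<close>. The result is a
  univariate polynomial that still has the coefficient \<open>c \<alpha>\<close>, so over an
  infinite domain it cannot vanish everywhere.\<close>

lemma sum_mon_nonzero:
  fixes c :: "('i::finite \<Rightarrow> nat) \<Rightarrow> 'a::{idom,ring_char_0}"
  assumes "\<alpha> \<le> e" "c \<alpha> \<noteq> 0"
  shows "\<exists>x. (\<Sum>\<beta>\<in>{..e}. c \<beta> * monomial_fun \<beta> x) \<noteq> 0"
proof (rule ccontr)
  assume "\<not> ?thesis"
  then have zero: "(\<Sum>\<beta>\<in>{..e}. c \<beta> * monomial_fun \<beta> x) = 0" for x by blast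
  obtain h where h: "bij_betw h (UNIV :: 'i set) {..<CARD('i)}"
    using ex_bij_betw_finite_nat[of "UNIV :: 'i set"] by (auto simp: atLeast0LessThan)
  \<comment> \<open>\<open>B\<close> exceeds every exponent allowed by \<open>e\<close>, so these
    exponents are digits in base \<open>B\<close>, and \<open>\<kappa> \<beta>\<close> is the number
    with the digits \<open>\<beta>\<close>.\<close>
  define B where "B = Suc (\<Sum>i\<in>UNIV. e i)"
  have B: "e i < B" for i
    unfolding B_def by (simp add: less_Suc_eq_le member_le_sum)
  define \<kappa> where "\<kappa> \<beta> = (\<Sum>i\<in>UNIV. \<beta> i * B ^ h i)" for \<beta> :: "'i \<Rightarrow> nat"
  have inj: "inj_on \<kappa> {..e}"
  proof (rule inj_onI)
    fix \<beta> \<gamma> assume bg: "\<beta> \<in> {..e}" "\<gamma> \<in> {..e}" and eq: "\<kappa> \<beta> = \<kappa> \<gamma>"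
    let ?g = "inv_into UNIV h"
    have gh: "?g (h i) = i" for i
      using h by (simp add: bij_betw_def)
    have \<kappa>: "\<kappa> \<delta> = (\<Sum>m<CARD('i). \<delta> (?g m) * B ^ m)" for \<delta>
      unfolding \<kappa>_def using sum.reindex_bij_betw[OF h, of "\<lambda>m. \<delta> (?g m) * B ^ m"] by (simp add: gh)
    have less: "\<delta> i < B" if "\<delta> \<in> {..e}" for \<delta> i
      using that B[of i] by (auto simp: le_fun_def intro: le_less_trans)
    show "\<beta> = \<gamma>"
    proof
      fix i
      have "h i < CARD('i)" using h by (auto simp: bij_betw_def)
      then show "\<beta> i = \<gamma> i"
        using digits_unique[of "CARD('i)" "\<lambda>m. \<beta> (?g m)" B "\<lambda>m. \<gamma> (?g m)" "h i"]
          less[OF bg(1)] less[OF bg(2)] eq by (simp add: \<kappa> gh)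
    qed
  qed
  define p where "p = (\<Sum>\<beta>\<in>{..e}. monom (c \<beta>) (\<kappa> \<beta>))"
  have "poly p t = 0" for t
  proof -
    have "monomial_fun \<beta> (\<lambda>i. t ^ (B ^ h i)) = t ^ \<kappa> \<beta>" for \<beta>
      by (simp add: monomial_fun_def \<kappa>_def power_sum mult.commute flip: power_mult)
    then show ?thesis
      using zero[of "\<lambda>i. t ^ (B ^ h i)"] by (simp add: p_def poly_sum poly_monom)
  qed
  then have "p = 0" by (metis poly_all_0_iff_0)
  moreover have "coeff p (\<kappa> \<alpha>) = c \<alpha>"
  proof -
    have "coeff p (\<kappa> \<alpha>) = (\<Sum>\<beta>\<in>{..e}. if \<beta> = \<alpha> then c \<beta> else 0)"
      unfolding p_def coeff_sum using inj assms(1)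
      by (intro sum.cong) (auto dest: inj_onD)
    then show ?thesis using assms(1) by simp
  qed
  ultimately show False using assms(2) by simp
qed

section \<open>Elimination\<close>

text \<open>Gaussian elimination: an equation with a nonzero coefficient is solved for one unknown
  \<open>p\<close>, which removes one equation and one unknown and so preserves the strict
  inequality.\<close>

lemma underdetermined_system_solution:
  fixes a :: "'e \<Rightarrow> 'u \<Rightarrow> 'a::field"
  assumes "finite E" "finite U" "card E < card U"
  shows "\<exists>c. (\<exists>u\<in>U. c u \<noteq> 0) \<and> (\<forall>e\<in>E. (\<Sum>u\<in>U. a e u * c u) = 0)"
  using assms
proof (induction E arbitrary: U a rule: finite_induct)
  case empty
  then have "U \<noteq> {}" by auto
  then show ?case by (auto intro!: exI[of _ "\<lambda>_. 1"])
next
  case (insert e E)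
  show ?case
  proof (cases "\<forall>u\<in>U. a e u = 0")
    case True
    then show ?thesis using insert.IH[of U a] insert.prems insert.hyps by auto
  next
    case False
    then obtain p where p: "p \<in> U" "a e p \<noteq> 0" by blast
    \<comment> \<open>Row \<open>f\<close> after subtracting the multiple of row \<open>e\<close>
      that clears column \<open>p\<close>.\<close>
    define a' where "a' f u = a f u - a f p * a e u / a e p" for f u
    have "card E < card (U - {p})"
      using p insert.prems insert.hyps by (simp add: card_Diff_singleton)
    then obtain c where c: "\<exists>u\<in>U - {p}. c u \<noteq> 0" "\<And>f. f \<in> E \<Longrightarrow> (\<Sum>u\<in>U - {p}. a' f u * c u) = 0"
      using insert.IH[of "U - {p}" a'] insert.prems by auto
    let ?s = "\<Sum>u\<in>U - {p}. a e u * c u"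
    define c' where "c' = c(p := - ?s / a e p)"
    have sum: "(\<Sum>u\<in>U. a f u * c' u) = a f p * (- ?s / a e p) + (\<Sum>u\<in>U - {p}. a f u * c u)" for f
      unfolding sum.remove[OF insert.prems(1) p(1)] by (auto simp: c'_def intro!: sum.cong)
    have "(\<Sum>u\<in>U. a f u * c' u) = 0" if "f \<in> E" for f
    proof -
      have "0 = (\<Sum>u\<in>U - {p}. a f u * c u - a f p / a e p * (a e u * c u))"
        using c(2)[OF that] by (simp add: a'_def algebra_simps)
      also have "\<dots> = (\<Sum>u\<in>U - {p}. a f u * c u) - a f p / a e p * ?s"
        by (simp add: sum_subtractf sum_distrib_left)
      finally show ?thesis by (simp add: sum)
    qed
    moreover have "(\<Sum>u\<in>U. a e u * c' u) = 0"
      using p by (simp add: sum)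
    moreover have "\<exists>u\<in>U. c' u \<noteq> 0"
      using c(1) by (auto simp: c'_def)
    ultimately show ?thesis by (intro exI[of _ c']) auto
  qed
qed

section \<open>A polynomial vanishing at all bad matrices\<close>

lemma prod_UNIV_sum:
  "(\<Prod>x\<in>(UNIV :: ('a::finite + 'b::finite) set). f x) = (\<Prod>a\<in>UNIV. f (Inl a)) * (\<Prod>b\<in>UNIV. f (Inr b))"
  unfolding UNIV_Plus_UNIV[symmetric] by (simp add: prod.Plus del: UNIV_Plus_UNIV)

text \<open>In the application \<open>W i\<close> is the \<open>i\<close>-th coordinate of
  \<open>P x - P y\<close>, and \<open>'v\<close> indexes the coordinates of \<open>x\<close> and
  \<open>y\<close> together. The coefficients \<open>c\<close> are found by counting: multiplying by
  a power of \<open>W j\<close> turns vanishing at the bad matrices into polynomial identities that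
  are linear in \<open>c\<close>.\<close>

lemma bad_matrices_polynomial:
  fixes W :: "'N::finite \<Rightarrow> ('v::finite \<Rightarrow> 'a::{field,ring_char_0}) \<Rightarrow> 'a"
  assumes W: "\<And>i. W i \<in> polys_le (\<lambda>_. d)"
    and card: "CARD('v) < CARD('k::finite)"
  shows "\<exists>D c. (\<exists>\<alpha>\<le>(\<lambda>_. D). c \<alpha> \<noteq> 0) \<and>
    (\<forall>l :: 'k \<times> 'N \<Rightarrow> 'a. \<forall>x. (\<exists>i. W i x \<noteq> 0) \<and> (\<forall>r. (\<Sum>i\<in>UNIV. l (r, i) * W i x) = 0) \<longrightarrow>
      (\<Sum>\<alpha>\<in>{..(\<lambda>_. D)}. c \<alpha> * monomial_fun \<alpha> l) = 0)"
proof -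
  let ?k = "CARD('k)" and ?N = "CARD('N)" and ?n = "CARD('v)"
  \<comment> \<open>\<open>C\<close> collects all factors independent of \<open>D\<close> in the
    bound for the number of equations. A single spare power of \<open>Suc D\<close> has to beat it,
    which \<open>D = C\<close> achieves.\<close>
  define C where "C = ?N * (Suc (d * ?k) ^ ?n * 2 ^ (?k * (?N - 1)))"
  define D where "D = C"
  \<comment> \<open>Bound for the multidegree of \<open>G j \<alpha>\<close>. Each of the
    \<open>k\<close> rows has degree at most
    \<open>d * (D - \<alpha> (r, j)) + d * \<alpha> (r, j) = d * D\<close> in \<open>x\<close>. An
    entry outside column \<open>j\<close> gets at most \<open>D\<close> from its own power and at
    most \<open>D\<close> from the power of the linear form.\<close>
  define e :: "'N \<Rightarrow> 'v + 'k \<times> 'N \<Rightarrow> nat" where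
    "e j = case_sum (\<lambda>_. ?k * (d * D)) (\<lambda>(r, i). if i = j then 0 else 2 * D)" for j
  \<comment> \<open>\<open>G j \<alpha> (case_sum x l)\<close> is \<open>W j x ^ (k * D) * monomial_fun \<alpha> l\<close> after \<open>l (r, j) * W j x\<close> has been
    replaced by minus the remaining terms of \<open>\<Sum>i. l (r, i) * W i x = 0\<close>, so column \<open>j\<close> of \<open>l\<close> does not occur.\<close>
  define G :: "'N \<Rightarrow> ('k \<times> 'N \<Rightarrow> nat) \<Rightarrow> ('v + 'k \<times> 'N \<Rightarrow> 'a) \<Rightarrow> 'a" where
    "G j \<alpha> z = (\<Prod>r\<in>UNIV. (\<Prod>i\<in>-{j}. z (Inr (r, i)) ^ \<alpha> (r, i)) *
       (W j (z \<circ> Inl) ^ (D - \<alpha> (r, j)) *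
        (- (\<Sum>i\<in>-{j}. z (Inr (r, i)) * W i (z \<circ> Inl))) ^ \<alpha> (r, j)))" for j \<alpha> z
  \<comment> \<open>One equation for each \<open>j\<close> and each monomial that may occur in
    \<open>G j \<alpha>\<close>.\<close>
  define E where "E = (SIGMA j:UNIV. {..e j})"
  have WG: "(\<lambda>z :: 'v + 'k \<times> 'N \<Rightarrow> 'a. W i (z \<circ> Inl)) \<in> polys_le (case_sum (\<lambda>_. d) (\<lambda>_. 0))" for i
  proof -
    obtain c where c: "W i = (\<lambda>x. \<Sum>\<alpha>\<in>{..(\<lambda>_. d)}. c \<alpha> * monomial_fun \<alpha> x)"
      using W[of i] by (auto simp: polys_le_def)
    have monomial_fun: "monomial_fun (case_sum \<alpha> (\<lambda>_. 0)) z = monomial_fun \<alpha> (z \<circ> Inl)"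
      for \<alpha> and z :: "'v + 'k \<times> 'N \<Rightarrow> 'a"
      by (simp add: monomial_fun_def prod_UNIV_sum)
    have "(\<lambda>z :: 'v + 'k \<times> 'N \<Rightarrow> 'a. monomial_fun \<alpha> (z \<circ> Inl)) \<in> polys_le (case_sum (\<lambda>_. d) (\<lambda>_. 0))"
      if "\<alpha> \<le> (\<lambda>_. d)" for \<alpha>
      unfolding monomial_fun[symmetric] using that
      by (intro monomial_fun_in_polys_le) (auto simp: le_fun_def split: sum.split)
    then show ?thesis unfolding c by (intro polys_le_sum polys_le_scale) auto
  qed
  have G: "G j \<alpha> \<in> polys_le (e j)" if \<alpha>: "\<alpha> \<le> (\<lambda>_. D)" for j \<alpha>
  proof -
    have aD: "\<alpha> q \<le> D" for q using le_funD[OF \<alpha>, of q] .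
    \<comment> \<open>Bound for the factor of row \<open>r\<close>: \<open>m\<close> in the
      variables of \<open>x\<close>, \<open>a\<close> in the entries of that row outside column
      \<open>j\<close>. Different rows involve different entries, so summing over \<open>r\<close>
      gives \<open>e j\<close>.\<close>
    let ?b = "\<lambda>m a r. case_sum (\<lambda>_. m) (\<lambda>(r', i). if r' = r \<and> i \<noteq> j then a else 0) :: 'v + 'k \<times> 'N \<Rightarrow> nat"
    have 1: "(\<lambda>z. \<Prod>i\<in>-{j}. z (Inr (r, i)) ^ \<alpha> (r, i)) \<in> polys_le (?b 0 D r)" for r
    proof (rule polys_le_mono[OF polys_le_prod[OF _ polys_le_power[OF polys_le_var]]])
      show "(\<lambda>q. \<Sum>i\<in>-{j}. \<alpha> (r, i) * (if q = Inr (r, i) then 1 else 0)) \<le> ?b 0 D r"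
      proof (rule le_funI)
        fix q :: "'v + 'k \<times> 'N"
        show "(\<Sum>i\<in>-{j}. \<alpha> (r, i) * (if q = Inr (r, i) then 1 else 0)) \<le> ?b 0 D r q"
        proof (cases "\<exists>i\<in>-{j}. q = Inr (r, i)")
          case True
          then obtain i where i: "i \<noteq> j" "q = Inr (r, i)" by auto
          have "(\<Sum>i'\<in>-{j}. \<alpha> (r, i') * (if q = Inr (r, i') then 1 else 0)) =
              (\<Sum>i'\<in>-{j}. if i = i' then \<alpha> (r, i') else 0)"
            using i by (intro sum.cong) auto
          then show ?thesis using i aD by simp
        next
          case False
          then have "(\<Sum>i\<in>-{j}. \<alpha> (r, i) * (if q = Inr (r, i) then 1 else 0)) = 0"
            by (intro sum.neutral) auto
          then show ?thesis by (simp only: le0)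
        qed
      qed
    qed simp
    have 2: "(\<lambda>z :: 'v + 'k \<times> 'N \<Rightarrow> 'a. W j (z \<circ> Inl) ^ (D - \<alpha> (r, j))) \<in>
        polys_le (\<lambda>q. (D - \<alpha> (r, j)) * case_sum (\<lambda>_. d) (\<lambda>_. 0) q)" for r
      by (rule polys_le_power[OF WG])
    have "(\<lambda>z. z (Inr (r, i)) * W i (z \<circ> Inl)) \<in> polys_le (?b d 1 r)" if "i \<noteq> j" for r i
      by (rule polys_le_mono[OF polys_le_mult[OF polys_le_var WG]])
        (use that in \<open>auto simp: le_fun_def split: sum.split\<close>)
    then have 3: "(\<lambda>z. (- (\<Sum>i\<in>-{j}. z (Inr (r, i)) * W i (z \<circ> Inl))) ^ \<alpha> (r, j)) \<in>
        polys_le (\<lambda>q. \<alpha> (r, j) * ?b d 1 r q)" for r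
      by (intro polys_le_power polys_le_uminus polys_le_sum) auto
    have "(\<lambda>z. (\<Prod>i\<in>-{j}. z (Inr (r, i)) ^ \<alpha> (r, i)) *
       (W j (z \<circ> Inl) ^ (D - \<alpha> (r, j)) *
        (- (\<Sum>i\<in>-{j}. z (Inr (r, i)) * W i (z \<circ> Inl))) ^ \<alpha> (r, j))) \<in> polys_le (?b (d * D) (2 * D) r)" for r
      by (rule polys_le_mono[OF polys_le_mult[OF 1 polys_le_mult[OF 2 3]]])
        (use aD[of "(r, j)"] in \<open>auto simp: le_fun_def mult.commute simp flip: distrib_left split: sum.split\<close>)
    then have "G j \<alpha> \<in> polys_le (\<lambda>q. \<Sum>r\<in>UNIV. ?b (d * D) (2 * D) r q)"
      unfolding G_def[abs_def] by (intro polys_le_prod) auto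
    moreover have "(\<Sum>r\<in>UNIV. ?b (d * D) (2 * D) r q) = e j q" for q
      by (cases q) (auto simp: e_def)
    ultimately show ?thesis by simp
  qed
  have key: "G j \<alpha> (case_sum x l) = W j x ^ (?k * D) * monomial_fun \<alpha> l"
    if \<alpha>: "\<alpha> \<le> (\<lambda>_. D)" and l: "\<And>r. (\<Sum>i\<in>UNIV. l (r, i) * W i x) = 0" for j \<alpha> x l
  proof -
    have 1: "- (\<Sum>i\<in>-{j}. l (r, i) * W i x) = l (r, j) * W j x" for r
      using l[of r] by (simp add: sum.remove[of UNIV j] Compl_eq_Diff_UNIV add_eq_0_iff)
    \<comment> \<open>The padding by \<open>W j x ^ (D - \<alpha> (r, j))\<close> makes every row
      contribute exactly \<open>D\<close> factors \<open>W j x\<close>. The common factor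
      \<open>W j x ^ (k * D)\<close> is therefore the same for all \<open>\<alpha>\<close>.\<close>
    have 2: "W j x ^ (D - \<alpha> (r, j)) * (l (r, j) * W j x) ^ \<alpha> (r, j) = W j x ^ D * l (r, j) ^ \<alpha> (r, j)" for r
    proof -
      have "W j x ^ D = W j x ^ (D - \<alpha> (r, j)) * W j x ^ \<alpha> (r, j)"
        using \<alpha> by (simp add: le_fun_def flip: power_add)
      then show ?thesis by (simp add: power_mult_distrib mult_ac)
    qed
    have 3: "(\<Prod>i\<in>-{j}. l (r, i) ^ \<alpha> (r, i)) * (W j x ^ D * l (r, j) ^ \<alpha> (r, j))
        = W j x ^ D * (\<Prod>i\<in>UNIV. l (r, i) ^ \<alpha> (r, i))" for r
      by (simp add: prod.remove[of UNIV j] Compl_eq_Diff_UNIV mult_ac)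
    have "case_sum x l \<circ> Inl = x" by auto
    then have "G j \<alpha> (case_sum x l) = (\<Prod>r\<in>UNIV. W j x ^ D * (\<Prod>i\<in>UNIV. l (r, i) ^ \<alpha> (r, i)))"
      by (simp add: G_def 1 2 3)
    also have "\<dots> = W j x ^ (?k * D) * (\<Prod>r\<in>UNIV. \<Prod>i\<in>UNIV. l (r, i) ^ \<alpha> (r, i))"
      by (simp add: prod.distrib mult.commute flip: power_mult)
    also have "(\<Prod>r\<in>UNIV. \<Prod>i\<in>UNIV. l (r, i) ^ \<alpha> (r, i)) = monomial_fun \<alpha> l"
      by (simp add: monomial_fun_def prod.cartesian_product)
    finally show ?thesis .
  qed
  \<comment> \<open>There are \<open>Suc D ^ (k * N)\<close> unknowns and at most
    \<open>C * Suc D ^ (n + k * (N - 1))\<close> equations. As \<open>n < k\<close>, the second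
    exponent is smaller by at least one, and \<open>C < Suc D\<close>.\<close>
  have count: "card E < card {..(\<lambda>_ :: 'k \<times> 'N. D)}"
  proof -
    have N: "0 < ?N" by simp
    have card_e: "card {..e j} = Suc (?k * (d * D)) ^ ?n * Suc (2 * D) ^ (?k * (?N - 1))" for j
    proof -
      have "card {..e j} = (\<Prod>v\<in>(UNIV :: 'v set). Suc (?k * (d * D))) *
          (\<Prod>q\<in>UNIV. Suc (case q of (r :: 'k, i) \<Rightarrow> if i = j then 0 else 2 * D))"
        by (simp add: card_atMost_fun prod_UNIV_sum e_def)
      also have "(\<Prod>q\<in>UNIV. Suc (case q of (r :: 'k, i) \<Rightarrow> if i = j then 0 else 2 * D))
          = (\<Prod>r\<in>(UNIV :: 'k set). \<Prod>i\<in>UNIV. Suc (if i = j then 0 else 2 * D))"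
        unfolding UNIV_Times_UNIV[symmetric] prod.cartesian_product by (intro prod.cong) auto
      also have "(\<Prod>i\<in>UNIV. Suc (if i = j then 0 else 2 * D)) = Suc (2 * D) ^ (?N - 1)"
      proof -
        have "(\<Prod>i\<in>UNIV. Suc (if i = j then 0 else 2 * D)) = (\<Prod>i\<in>UNIV - {j}. Suc (2 * D))"
          by (subst prod.remove[of UNIV j]) (auto intro: prod.cong)
        then show ?thesis by (simp add: card_Diff_singleton)
      qed
      finally show ?thesis by (simp add: mult.commute flip: power_mult)
    qed
    have "card E = (\<Sum>j\<in>(UNIV :: 'N set). card {..e j})"
      unfolding E_def by (rule card_SigmaI) auto
    also have "\<dots> = ?N * (Suc (?k * (d * D)) ^ ?n * Suc (2 * D) ^ (?k * (?N - 1)))"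
      by (simp add: card_e)
    also have "\<dots> \<le> ?N * ((Suc (d * ?k) * Suc D) ^ ?n * (2 * Suc D) ^ (?k * (?N - 1)))"
      by (intro mult_le_mono2 mult_le_mono power_mono) (auto simp: algebra_simps)
    also have "\<dots> = C * Suc D ^ (?n + ?k * (?N - 1))"
      by (simp only: C_def power_mult_distrib power_add mult_ac)
    also have "\<dots> < Suc D * Suc D ^ (?n + ?k * (?N - 1))"
      by (simp add: D_def)
    also have "\<dots> = Suc D ^ (Suc ?n + ?k * (?N - 1))" by simp
    also have "\<dots> \<le> Suc D ^ (?k + ?k * (?N - 1))"
      using card by (intro power_increasing) auto
    also have "?k + ?k * (?N - 1) = ?k * ?N"
      using N by (cases ?N) auto
    also have "Suc D ^ (?k * ?N) = card {..(\<lambda>_ :: 'k \<times> 'N. D)}"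
      by (simp add: card_atMost_fun)
    finally show ?thesis .
  qed
  define T where "T j \<alpha> = (SOME t. \<forall>z. G j \<alpha> z = (\<Sum>\<beta>\<in>{..e j}. t \<beta> * monomial_fun \<beta> z))" for j \<alpha>
  have T: "G j \<alpha> z = (\<Sum>\<beta>\<in>{..e j}. T j \<alpha> \<beta> * monomial_fun \<beta> z)" if "\<alpha> \<le> (\<lambda>_. D)" for j \<alpha> z
  proof -
    have "\<exists>t. \<forall>z. G j \<alpha> z = (\<Sum>\<beta>\<in>{..e j}. t \<beta> * monomial_fun \<beta> z)"
      using G[OF that] by (simp add: polys_le_def)
    from someI_ex[OF this] show ?thesis unfolding T_def by blast
  qed
  have "finite E" unfolding E_def by auto
  \<comment> \<open>The unknowns are the \<open>c \<alpha>\<close>; equation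
    \<open>(j, \<beta>)\<close> makes the coefficient of the monomial \<open>\<beta>\<close> in
    \<open>\<Sum>\<alpha>. c \<alpha> * G j \<alpha>\<close> zero. One \<open>c\<close> serves all
    \<open>j\<close> at once.\<close>
  from underdetermined_system_solution[OF this _ count, of "\<lambda>(j, \<beta>) \<alpha>. T j \<alpha> \<beta>"]
  obtain c where c: "\<exists>\<alpha>\<le>(\<lambda>_. D). c \<alpha> \<noteq> 0"
    and c0: "\<And>j \<beta>. \<beta> \<le> e j \<Longrightarrow> (\<Sum>\<alpha>\<in>{..(\<lambda>_. D)}. T j \<alpha> \<beta> * c \<alpha>) = 0"
    by (auto simp: E_def)
  have Gc: "(\<Sum>\<alpha>\<in>{..(\<lambda>_. D)}. c \<alpha> * G j \<alpha> z) = 0" for j z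
  proof -
    have "(\<Sum>\<alpha>\<in>{..(\<lambda>_. D)}. c \<alpha> * G j \<alpha> z)
        = (\<Sum>\<alpha>\<in>{..(\<lambda>_. D)}. \<Sum>\<beta>\<in>{..e j}. T j \<alpha> \<beta> * c \<alpha> * monomial_fun \<beta> z)"
      by (intro sum.cong) (auto simp: T sum_distrib_left mult_ac)
    also have "\<dots> = (\<Sum>\<beta>\<in>{..e j}. (\<Sum>\<alpha>\<in>{..(\<lambda>_. D)}. T j \<alpha> \<beta> * c \<alpha>) * monomial_fun \<beta> z)"
      by (subst sum.swap) (simp add: sum_distrib_right)
    also have "\<dots> = 0" by (simp add: c0)
    finally show ?thesis .
  qed
  \<comment> \<open>The identity \<open>Gc\<close> is evaluated at the bad matrix, and the nonzero
    factor \<open>W j x ^ (k * D)\<close> is cancelled.\<close>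
  have "(\<Sum>\<alpha>\<in>{..(\<lambda>_. D)}. c \<alpha> * monomial_fun \<alpha> l) = 0"
    if "W j x \<noteq> 0" and l: "\<And>r. (\<Sum>i\<in>UNIV. l (r, i) * W i x) = 0" for l x j
  proof -
    have "W j x ^ (?k * D) * (\<Sum>\<alpha>\<in>{..(\<lambda>_. D)}. c \<alpha> * monomial_fun \<alpha> l)
        = (\<Sum>\<alpha>\<in>{..(\<lambda>_. D)}. c \<alpha> * G j \<alpha> (case_sum x l))"
      unfolding sum_distrib_left using l by (intro sum.cong) (auto simp: key mult_ac)
    then show ?thesis using that(1) by (simp add: Gc)
  qed
  then show ?thesis using c by blast
qed

theorem theorem3p1:
  fixes G :: "('g, 'm) monoid_scheme"
    and \<phi> :: "'g \<Rightarrow> complex ^ 'n \<Rightarrow> complex ^ 'n"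
    and P :: "complex ^ 'n \<Rightarrow> complex ^ 'N"
  assumes "group_action G UNIV \<phi>"
    and "polynomial_map P"
    and "invariant_map G \<phi> P"
    and "inj_on (induced_map P) (orbits G UNIV \<phi>)"
    and "CARD('k::finite) \<ge> 2 * CARD('n) + 1"
  shows "generic_linear_map (\<lambda>l :: complex ^ 'N \<Rightarrow> complex ^ 'k.
           inj_on (l \<circ> induced_map P) (orbits G UNIV \<phi>))"
proof -
  obtain p where p: "\<And>i. complex_polynomial (p i)" and P: "\<And>i x. P x $ i = p i (\<lambda>m. x $ m)"
    using assms(2) unfolding polynomial_map_def by metis
  \<comment> \<open>The index type \<open>'n + 'n\<close> encodes the pair \<open>(x, y)\<close>;
    its cardinality is the \<open>2 n\<close> of the hypothesis on \<open>k\<close>.\<close>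
  define W :: "'N \<Rightarrow> ('n + 'n \<Rightarrow> complex) \<Rightarrow> complex"
    where "W i x = p i (\<lambda>m. x (Inl m)) - p i (\<lambda>m. x (Inr m))" for i x
  \<comment> \<open>Stated for all larger bounds, so that the finitely many \<open>W i\<close> can
    share one.\<close>
  have "\<exists>d. \<forall>d'\<ge>d. W i \<in> polys_le (\<lambda>_. d')" for i
  proof -
    obtain d1 d2 where "\<forall>d'\<ge>d1. (\<lambda>x :: 'n + 'n \<Rightarrow> complex. p i (\<lambda>m. x (Inl m))) \<in> polys_le (\<lambda>_. d')"
      "\<forall>d'\<ge>d2. (\<lambda>x :: 'n + 'n \<Rightarrow> complex. p i (\<lambda>m. x (Inr m))) \<in> polys_le (\<lambda>_. d')"
      using complex_polynomial_reindex_polys_le[OF p[of i]] by metis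
    then show ?thesis
      unfolding W_def[abs_def] by (intro exI[of _ "max d1 d2"]) (auto intro: polys_le_diff)
  qed
  then obtain d where d: "\<And>i d'. d i \<le> d' \<Longrightarrow> W i \<in> polys_le (\<lambda>_. d')"
    by metis
  have W: "W i \<in> polys_le (\<lambda>_. \<Sum>i\<in>UNIV. d i)" for i
    by (intro d member_le_sum) auto
  have "CARD('n + 'n) < CARD('k)" using assms(5) by simp
  from bad_matrices_polynomial[of W, OF W this] obtain D c
    where c: "\<exists>\<alpha>\<le>(\<lambda>_. D). c \<alpha> \<noteq> 0"
      and van: "\<forall>(l :: 'k \<times> 'N \<Rightarrow> complex) x. (\<exists>i. W i x \<noteq> 0) \<and>
        (\<forall>r. (\<Sum>i\<in>UNIV. l (r, i) * W i x) = 0) \<longrightarrow> (\<Sum>\<alpha>\<in>{..(\<lambda>_. D)}. c \<alpha> * monomial_fun \<alpha> l) = 0"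
    by blast
  define F where "F l = (\<Sum>\<alpha>\<in>{..(\<lambda>_. D)}. c \<alpha> * monomial_fun \<alpha> l)" for l :: "'k \<times> 'N \<Rightarrow> complex"
  \<comment> \<open>The exceptional set is a single hypersurface; it is proper because
    \<open>F\<close> has a nonzero coefficient.\<close>
  define Z :: "(complex ^ 'N ^ 'k) set" where "Z = {A. F (\<lambda>(i, j). A $ i $ j) = 0}"
  have "complex_polynomial F"
    unfolding complex_polynomial_def F_def monomial_fun_def by (intro exI[of _ "{..(\<lambda>_. D)}"] exI[of _ c]) simp
  then have "zariski_closed Z"
    unfolding zariski_closed_def Z_def by (intro exI[of _ "{F}"]) simp
  moreover have "Z \<noteq> UNIV"
  proof -
    obtain l where l: "F l \<noteq> 0"
      using c sum_mon_nonzero unfolding F_def by metis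
    have eq: "(\<lambda>(i, j). (\<chi> i j. l (i, j)) $ i $ j) = l" by auto
    have "(\<chi> i j. l (i, j)) \<notin> Z" unfolding Z_def mem_Collect_eq eq by (rule l)
    then show ?thesis by blast
  qed
  moreover have "inj_on (l \<circ> induced_map P) (orbits G UNIV \<phi>)"
    if lin: "Vector_Spaces.linear (*s) (*s) l" and nZ: "matrix l \<notin> Z" for l :: "complex ^ 'N \<Rightarrow> complex ^ 'k"
  proof (rule inj_onI)
    fix X Y assume X: "X \<in> orbits G UNIV \<phi>" and Y: "Y \<in> orbits G UNIV \<phi>"
      and eq: "(l \<circ> induced_map P) X = (l \<circ> induced_map P) Y"
    obtain x y where xy: "X = orbit G \<phi> x" "Y = orbit G \<phi> y"
      using X Y by (auto simp: orbits_def)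
    have ind: "induced_map P X = P x" "induced_map P Y = P y"
      unfolding xy using induced_map_orbit[OF assms(1,3)] by auto
    have "matrix l *v (P x - P y) = l (P x) - l (P y)"
      using lin by (simp add: matrix_works vec.linear_diff)
    then have l0: "matrix l *v (P x - P y) = 0" using eq by (simp add: ind)
    let ?z = "case_sum (\<lambda>m. x $ m) (\<lambda>m. y $ m)"
    have Wz: "W i ?z = (P x - P y) $ i" for i
      by (simp add: W_def P)
    \<comment> \<open>Otherwise \<open>P x - P y\<close> is a nonzero kernel vector of the form
      covered by \<open>van\<close>, which puts \<open>matrix l\<close> into
      \<open>Z\<close>.\<close>
    have "P x = P y"
    proof (rule ccontr)
      assume "P x \<noteq> P y"
      then obtain i where "W i ?z \<noteq> 0"
        unfolding Wz by (auto simp: vec_eq_iff)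
      moreover have "(\<Sum>i\<in>UNIV. (case (r, i) of (r, i) \<Rightarrow> matrix l $ r $ i) * W i ?z) = 0" for r
        using arg_cong[OF l0, of "\<lambda>v. v $ r"] unfolding Wz by (simp add: matrix_vector_mult_def)
      ultimately have "F (\<lambda>(r, i). matrix l $ r $ i) = 0"
        unfolding F_def using van by blast
      then show False using nZ by (simp add: Z_def)
    qed
    then show "X = Y"
      using inj_onD[OF assms(4) _ X Y] ind by simp
  qed
  ultimately show ?thesis
    unfolding generic_linear_map_def by blast
qed

end
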